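(* Let $\mathcal{I}$ be an implementation of a shared object $(Q,q_0,O,R,\sigma)$. If the induced conflict relation satisfies $\asymp\, = O\times O$ (i.e., every pair of operations conflicts), then $\mathcal{I}$ is conflict-obstruction-free if and only if $\mathcal{I}$ is obstruction-free.
   Context: **Objects.** A sequential object is a tuple $(Q,q_0,O,R,\sigma)$: $Q$ a set of states, $q_0\in Q$ the initial state, $O$ a set of operations, $R$ a set of responses, $\sigma:O\times Q\to R\times Q$ a state transition function giving the response and next state. For a sequence $s\in O^*$ and $q\in Q$, $s(q)$ is the state obtained by applying the operations of $s$ in order from $q$; $s\cdot s'$ is concatenation. Operations $o,o'\in O$ commute in state $q$ if $o\cdot o'(q)=o'\cdot o(q)$ and each of the two operations returns the same response in both orders. They conflict, written $o\asymp o'$, if there is a state $q\in Q$ in which they do not commute. **Model.** There are $n$ asynchronous deterministic processes communicating through atomic read-write registers. Any number of processes may crash (stop taking steps). An implementation (algorithm) consists of one deterministic automaton per process. Each process has at most one pending operation at a time. When a process invokes an operation it takes steps according to its automaton; each step consists of local computation and one read or write of a register, after which the process updates its local state and possibly returns a response to its pending operation. An execution is a finite or infinite sequence of steps of the processes, following their automata, from the initial configuration. **Operation instances.** An operation instance $\Phi=(x,o,p)$ is an invocation by process $p$ of operation $o$ on object $x$ (here $x$ is the single implemented object). It completes in an execution $\alpha$ if it returns a response in $\alpha$; otherwise it is pending. $\Phi$ takes a step in $\alpha$ when $p$ takes a step after invoking $\Phi$ and while $\Phi$ has not yet returned. All steps are steps of operation instances. In an infinite execution a process is correct if it takes infinitely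 many steps or has no pending operation; otherwise it is faulty. **Obstruction-freedom.** $\Phi$ is eventually step-contention free in $\alpha$ if either $\Phi$ completes in $\alpha$, or there is a suffix of $\alpha$ in which only $\Phi$ takes steps. An implementation is obstruction-free if, for every infinite execution $\alpha$, any operation instance $\Phi$ invoked by a correct process completes in $\alpha$ whenever $\Phi$ is eventually step-contention free in $\alpha$. **Conflict-obstruction-freedom.** $\Phi=(x,o,p)$ is eventually conflict-step-contention free in $\alpha$ if either $\Phi$ completes in $\alpha$, or there is a suffix of $\alpha$ in which no other operation instance $\Phi'=(x,o',q)$ with $o\asymp o'$ takes steps. An implementation is conflict-obstruction-free if, for every infinite execution $\alpha$ and every operation instance $\Phi$ invoked by a correct process that is eventually conflict-step-contention free in $\alpha$, $\Phi$ completes in $\alpha$. *)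

theory Defs
  imports Main
begin

section \<open>Sequential objects and conflicts\<close>

record ('q, 'o, 'r) seq_object =
  states :: "'q set"
  init_state :: "'q"
  ops :: "'o set"
  resps :: "'r set"
  trans_fun :: "'o \<times> 'q \<Rightarrow> 'r \<times> 'q"

definition sequential_object :: "('q, 'o, 'r) seq_object \<Rightarrow> bool" where
  "sequential_object X \<longleftrightarrow>
     init_state X \<in> states X \<and>
     trans_fun X ` (ops X \<times> states X) \<subseteq> resps X \<times> states X"

text \<open>\<open>apply_ops X s q\<close> is the state $s(q)$; the head of the list is applied first.\<close>

primrec apply_ops :: "('q, 'o, 'r) seq_object \<Rightarrow> 'o list \<Rightarrow> 'q \<Rightarrow> 'q" where
  "apply_ops X [] q = q"
| "apply_ops X (a # s) q = apply_ops X s (snd (trans_fun X (a, q)))"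

definition response :: "('q, 'o, 'r) seq_object \<Rightarrow> 'o \<Rightarrow> 'q \<Rightarrow> 'r" where
  "response X a q = fst (trans_fun X (a, q))"

definition commute_in :: "('q, 'o, 'r) seq_object \<Rightarrow> 'q \<Rightarrow> 'o \<Rightarrow> 'o \<Rightarrow> bool" where
  "commute_in X q a b \<longleftrightarrow>
     apply_ops X ([a] @ [b]) q = apply_ops X ([b] @ [a]) q \<and>
     response X a q = response X a (apply_ops X [b] q) \<and>
     response X b q = response X b (apply_ops X [a] q)"

definition conflict_rel :: "('q, 'o, 'r) seq_object \<Rightarrow> ('o \<times> 'o) set" where
  "conflict_rel X =
     {(a, b). a \<in> ops X \<and> b \<in> ops X \<and> (\<exists>q \<in> states X. \<not> commute_in X q a b)}"


section \<open>Implementations from read-write registers\<close>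

text \<open>
  The shared-memory access performed in one step: reading a register or writing a value to it.
  The result of the access is the new local state together with the response, if any, that is
  returned to the pending operation; after a read it depends on the value that was read.
\<close>

datatype ('g, 'v, 'l, 'r) access =
  Read 'g "'v \<Rightarrow> 'l \<times> 'r option"
| Write 'g 'v "'l \<times> 'r option"

record ('g, 'v, 'l, 'o, 'r) automaton =
  init_local :: "'l"
  on_invoke :: "'o \<Rightarrow> 'l \<Rightarrow> 'l"
  next_access :: "'l \<Rightarrow> ('g, 'v, 'l, 'r) access"

text \<open>
  The processes are the elements of the type \<open>'p\<close>, which is of class \<open>finite\<close> in all notions
  below that concern executions; the number of processes is \<open>CARD('p)\<close>. Distinct processes may
  run entirely different automata; only the type of local states is shared.
\<close>

record ('p, 'g, 'v, 'l, 'o, 'r) impl =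
  automata :: "'p \<Rightarrow> ('g, 'v, 'l, 'o, 'r) automaton"
  init_regs :: "'g \<Rightarrow> 'v"

fun access_resps :: "('g, 'v, 'l, 'r) access \<Rightarrow> 'r set" where
  "access_resps (Read g f) = {r. \<exists>v. snd (f v) = Some r}"
| "access_resps (Write g v u) = {r. snd u = Some r}"

text \<open>
  That only operations of the object are invoked is part of the definition of executions below.
\<close>

definition implementation_of ::
    "('p::finite, 'g, 'v, 'l, 'o, 'r) impl \<Rightarrow> ('q, 'o, 'r) seq_object \<Rightarrow> bool" where
  "implementation_of I X \<longleftrightarrow>
     (\<forall>p l. access_resps (next_access (automata I p) l) \<subseteq> resps X)"


section \<open>Executions\<close>

text \<open>
  Invocations are recorded in executions as separate events, and they are not counted as steps:
  a step always includes a register access.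
\<close>

datatype ('p, 'o) event = Invoke 'p 'o | Step 'p

record ('p, 'g, 'v, 'l, 'o) config =
  local_st :: "'p \<Rightarrow> 'l"
  regs :: "'g \<Rightarrow> 'v"
  pending_op :: "'p \<Rightarrow> 'o option"

definition init_config ::
    "('p, 'g, 'v, 'l, 'o, 'r) impl \<Rightarrow> ('p, 'g, 'v, 'l, 'o) config" where
  "init_config I =
     \<lparr>local_st = (\<lambda>p. init_local (automata I p)), regs = init_regs I, pending_op = (\<lambda>_. None)\<rparr>"

definition access_of ::
    "('p, 'g, 'v, 'l, 'o, 'r) impl \<Rightarrow> ('p, 'g, 'v, 'l, 'o) config \<Rightarrow> 'p \<Rightarrow>
     ('g, 'v, 'l, 'r) access" where
  "access_of I C p = next_access (automata I p) (local_st C p)"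

definition access_result ::
    "('p, 'g, 'v, 'l, 'o, 'r) impl \<Rightarrow> ('p, 'g, 'v, 'l, 'o) config \<Rightarrow> 'p \<Rightarrow> 'l \<times> 'r option" where
  "access_result I C p =
     (case access_of I C p of Read g f \<Rightarrow> f (regs C g) | Write g v u \<Rightarrow> u)"

definition regs_after ::
    "('p, 'g, 'v, 'l, 'o, 'r) impl \<Rightarrow> ('p, 'g, 'v, 'l, 'o) config \<Rightarrow> 'p \<Rightarrow> 'g \<Rightarrow> 'v" where
  "regs_after I C p =
     (case access_of I C p of Read g f \<Rightarrow> regs C | Write g v u \<Rightarrow> (regs C)(g := v))"

fun exec_event ::
    "('p, 'g, 'v, 'l, 'o, 'r) impl \<Rightarrow> ('p, 'o) event \<Rightarrow> ('p, 'g, 'v, 'l, 'o) config \<Rightarrow>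
     ('p, 'g, 'v, 'l, 'o) config" where
  "exec_event I (Invoke p a) C =
     C\<lparr>local_st := (local_st C)(p := on_invoke (automata I p) a (local_st C p)),
       pending_op := (pending_op C)(p := Some a)\<rparr>"
| "exec_event I (Step p) C =
     C\<lparr>local_st := (local_st C)(p := fst (access_result I C p)),
       regs := regs_after I C p,
       pending_op := (case snd (access_result I C p) of
          None \<Rightarrow> pending_op C | Some r \<Rightarrow> (pending_op C)(p := None))\<rparr>"

fun enabled ::
    "('q, 'o, 'r) seq_object \<Rightarrow> ('p, 'o) event \<Rightarrow> ('p, 'g, 'v, 'l, 'o) config \<Rightarrow> bool" where
  "enabled X (Invoke p a) C \<longleftrightarrow> a \<in> ops X \<and> pending_op C p = None"
| "enabled X (Step p) C \<longleftrightarrow> pending_op C p \<noteq> None"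

text \<open>
  The automata are deterministic, so the sequence of events determines the configurations:
  \<open>config_at I \<alpha> k\<close> is the configuration just before event \<open>k\<close>.
\<close>

primrec config_at ::
    "('p, 'g, 'v, 'l, 'o, 'r) impl \<Rightarrow> (nat \<Rightarrow> ('p, 'o) event) \<Rightarrow> nat \<Rightarrow>
     ('p, 'g, 'v, 'l, 'o) config" where
  "config_at I \<alpha> 0 = init_config I"
| "config_at I \<alpha> (Suc k) = exec_event I (\<alpha> k) (config_at I \<alpha> k)"

text \<open>
  The progress conditions only concern infinite executions. Since there are finitely many
  processes and each has at most one pending operation, an infinite sequence of events contains
  infinitely many steps.
\<close>

definition infinite_execution ::
    "('q, 'o, 'r) seq_object \<Rightarrow> ('p::finite, 'g, 'v, 'l, 'o, 'r) impl \<Rightarrow>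
     (nat \<Rightarrow> ('p, 'o) event) \<Rightarrow> bool" where
  "infinite_execution X I \<alpha> \<longleftrightarrow> (\<forall>k. enabled X (\<alpha> k) (config_at I \<alpha> k))"


section \<open>Operation instances\<close>

text \<open>
  The position of the invocation distinguishes several invocations of the same operation by the
  same process. The object is left implicit, because there is only one.
\<close>

record ('p, 'o) op_instance =
  inst_pos :: nat
  inst_op :: 'o
  inst_proc :: 'p

definition instance_in :: "(nat \<Rightarrow> ('p, 'o) event) \<Rightarrow> ('p, 'o) op_instance \<Rightarrow> bool" where
  "instance_in \<alpha> \<Phi> \<longleftrightarrow> \<alpha> (inst_pos \<Phi>) = Invoke (inst_proc \<Phi>) (inst_op \<Phi>)"

definition returns_at ::
    "('p, 'g, 'v, 'l, 'o, 'r) impl \<Rightarrow> (nat \<Rightarrow> ('p, 'o) event) \<Rightarrow> 'p \<Rightarrow> nat \<Rightarrow> bool" where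
  "returns_at I \<alpha> p k \<longleftrightarrow> \<alpha> k = Step p \<and> snd (access_result I (config_at I \<alpha> k) p) \<noteq> None"

definition takes_step_at ::
    "('p, 'g, 'v, 'l, 'o, 'r) impl \<Rightarrow> (nat \<Rightarrow> ('p, 'o) event) \<Rightarrow> ('p, 'o) op_instance \<Rightarrow>
     nat \<Rightarrow> bool" where
  "takes_step_at I \<alpha> \<Phi> k \<longleftrightarrow>
     inst_pos \<Phi> < k \<and> \<alpha> k = Step (inst_proc \<Phi>) \<and>
     (\<forall>j. inst_pos \<Phi> < j \<and> j < k \<longrightarrow> \<not> returns_at I \<alpha> (inst_proc \<Phi>) j)"

definition completes ::
    "('p, 'g, 'v, 'l, 'o, 'r) impl \<Rightarrow> (nat \<Rightarrow> ('p, 'o) event) \<Rightarrow> ('p, 'o) op_instance \<Rightarrow> bool" where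
  "completes I \<alpha> \<Phi> \<longleftrightarrow>
     (\<exists>k. takes_step_at I \<alpha> \<Phi> k \<and> returns_at I \<alpha> (inst_proc \<Phi>) k)"

definition correct ::
    "('p, 'g, 'v, 'l, 'o, 'r) impl \<Rightarrow> (nat \<Rightarrow> ('p, 'o) event) \<Rightarrow> 'p \<Rightarrow> bool" where
  "correct I \<alpha> p \<longleftrightarrow>
     infinite {k. \<alpha> k = Step p} \<or>
     (\<nexists>\<Phi>. instance_in \<alpha> \<Phi> \<and> inst_proc \<Phi> = p \<and> \<not> completes I \<alpha> \<Phi>)"


section \<open>Progress conditions\<close>

definition ev_step_contention_free ::
    "('p, 'g, 'v, 'l, 'o, 'r) impl \<Rightarrow> (nat \<Rightarrow> ('p, 'o) event) \<Rightarrow> ('p, 'o) op_instance \<Rightarrow> bool" where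
  "ev_step_contention_free I \<alpha> \<Phi> \<longleftrightarrow>
     completes I \<alpha> \<Phi> \<or>
     (\<exists>N. \<forall>k\<ge>N. \<forall>p. \<alpha> k = Step p \<longrightarrow> takes_step_at I \<alpha> \<Phi> k)"

definition obstruction_free ::
    "('q, 'o, 'r) seq_object \<Rightarrow> ('p::finite, 'g, 'v, 'l, 'o, 'r) impl \<Rightarrow> bool" where
  "obstruction_free X I \<longleftrightarrow>
     (\<forall>\<alpha> \<Phi>. infinite_execution X I \<alpha> \<and> instance_in \<alpha> \<Phi> \<and> correct I \<alpha> (inst_proc \<Phi>) \<and>
        ev_step_contention_free I \<alpha> \<Phi> \<longrightarrow> completes I \<alpha> \<Phi>)"

definition ev_conflict_step_contention_free ::
    "('q, 'o, 'r) seq_object \<Rightarrow> ('p, 'g, 'v, 'l, 'o, 'r) impl \<Rightarrow> (nat \<Rightarrow> ('p, 'o) event) \<Rightarrow>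
     ('p, 'o) op_instance \<Rightarrow> bool" where
  "ev_conflict_step_contention_free X I \<alpha> \<Phi> \<longleftrightarrow>
     completes I \<alpha> \<Phi> \<or>
     (\<exists>N. \<forall>k\<ge>N. \<nexists>\<Phi>'. instance_in \<alpha> \<Phi>' \<and> \<Phi>' \<noteq> \<Phi> \<and>
        (inst_op \<Phi>, inst_op \<Phi>') \<in> conflict_rel X \<and> takes_step_at I \<alpha> \<Phi>' k)"

definition conflict_obstruction_free ::
    "('q, 'o, 'r) seq_object \<Rightarrow> ('p::finite, 'g, 'v, 'l, 'o, 'r) impl \<Rightarrow> bool" where
  "conflict_obstruction_free X I \<longleftrightarrow>
     (\<forall>\<alpha> \<Phi>. infinite_execution X I \<alpha> \<and> instance_in \<alpha> \<Phi> \<and> correct I \<alpha> (inst_proc \<Phi>) \<and>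
        ev_conflict_step_contention_free X I \<alpha> \<Phi> \<longrightarrow> completes I \<alpha> \<Phi>)"

end

theory Submission
  imports Defs
begin

text \<open>
  Every step belongs to exactly one operation instance: it exists because a step requires a pending
  operation, and it is unique because a process cannot invoke again before its pending operation
  has returned. If all operations conflict, the steps that conflict-step-contention freedom forbids
  are therefore exactly the steps of instances other than \<open>\<Phi>\<close>, so the two contention conditions
  coincide.
\<close>

text \<open>Recasts one event in terms of \<open>returns_at\<close>, so that the inductions below
  need not look inside \<open>access_result\<close>.\<close>

lemma pending_op_Suc:
  "pending_op (config_at I \<alpha> (Suc k)) p =
     (if returns_at I \<alpha> p k then None
      else case \<alpha> k of
        Invoke q a \<Rightarrow> if q = p then Some a else pending_op (config_at I \<alpha> k) p
      | Step q \<Rightarrow> pending_op (config_at I \<alpha> k) p)"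
  by (cases "\<alpha> k") (auto simp: returns_at_def split: option.splits)

text \<open>The witness is the latest invocation: what is pending after event \<open>k\<close> was
  either invoked by that event or was already pending and survived it.\<close>

lemma pending_op_invoked:
  assumes "pending_op (config_at I \<alpha> k) p = Some a"
  shows "\<exists>j<k. \<alpha> j = Invoke p a \<and> (\<forall>i. j < i \<and> i < k \<longrightarrow> \<not> returns_at I \<alpha> p i)"
  using assms
proof (induction k)
  case 0
  then show ?case by (simp add: init_config_def)
next
  case (Suc k)
  have no_return: "\<not> returns_at I \<alpha> p k"
    using Suc.prems by (auto simp: pending_op_Suc simp del: config_at.simps)
  consider "\<alpha> k = Invoke p a" | "pending_op (config_at I \<alpha> k) p = Some a"
    using Suc.prems
    by (auto simp: pending_op_Suc simp del: config_at.simps split: event.splits if_splits)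
  then show ?case
  proof cases
    case 1
    \<comment> \<open>No index lies strictly between \<open>k\<close> and \<open>Suc k\<close>, so
      the no-return condition is vacuous.\<close>
    then show ?thesis by (intro exI[of _ k]) auto
  next
    case 2
    then obtain j where "j < k" "\<alpha> j = Invoke p a"
        "\<forall>i. j < i \<and> i < k \<longrightarrow> \<not> returns_at I \<alpha> p i"
      using Suc.IH by blast
    with no_return show ?thesis by (intro exI[of _ j]) (auto simp: less_Suc_eq)
  qed
qed

text \<open>Only a return clears the entry. Since \<alpha> is arbitrary here, a further invocation
  by \<open>p\<close> could overwrite \<open>a\<close>; hence \<open>\<noteq> None\<close> rather
  than \<open>Some a\<close>.\<close>

lemma pending_op_persists:
  assumes "\<alpha> j = Invoke p a" "j < k" "\<forall>i. j < i \<and> i < k \<longrightarrow> \<not> returns_at I \<alpha> p i"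
  shows "pending_op (config_at I \<alpha> k) p \<noteq> None"
  using assms(2,3)
proof (induction k)
  case (Suc k)
  show ?case
  proof (cases "j = k")
    case True
    then show ?thesis using assms(1) by simp
  next
    case False
    then have "j < k" using Suc.prems(1) by simp
    then have "pending_op (config_at I \<alpha> k) p \<noteq> None" "\<not> returns_at I \<alpha> p k"
      using Suc.IH Suc.prems(2) by auto
    then show ?thesis
      by (simp add: pending_op_Suc del: config_at.simps split: event.splits)
  qed
qed simp

lemma step_of_some_instance:
  assumes "infinite_execution X I \<alpha>" "\<alpha> k = Step p"
  shows "\<exists>\<Phi>. instance_in \<alpha> \<Phi> \<and> takes_step_at I \<alpha> \<Phi> k"
proof -
  have "enabled X (Step p) (config_at I \<alpha> k)"
    using assms by (metis infinite_execution_def)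
  then obtain a where "pending_op (config_at I \<alpha> k) p = Some a"
    by auto
  then obtain j where "j < k" "\<alpha> j = Invoke p a"
      "\<forall>i. j < i \<and> i < k \<longrightarrow> \<not> returns_at I \<alpha> p i"
    by (blast dest: pending_op_invoked)
  then show ?thesis
    using assms(2)
    by (intro exI[of _ "\<lparr>inst_pos = j, inst_op = a, inst_proc = p\<rparr>"])
       (simp add: instance_in_def takes_step_at_def)
qed

text \<open>Without a return before \<open>k\<close>, the operation is still pending at
  \<open>j\<close>, which disables every invocation by its process.\<close>

lemma no_step_after_reinvocation:
  assumes "infinite_execution X I \<alpha>" "instance_in \<alpha> \<Phi>" "takes_step_at I \<alpha> \<Phi> k"
    and "inst_pos \<Phi> < j" "j < k"
  shows "\<alpha> j \<noteq> Invoke (inst_proc \<Phi>) a"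
proof
  assume "\<alpha> j = Invoke (inst_proc \<Phi>) a"
  moreover have "enabled X (\<alpha> j) (config_at I \<alpha> j)"
    using assms(1) by (simp add: infinite_execution_def)
  ultimately have "pending_op (config_at I \<alpha> j) (inst_proc \<Phi>) = None" by simp
  moreover have "pending_op (config_at I \<alpha> j) (inst_proc \<Phi>) \<noteq> None"
    using assms(2-5)
    by (intro pending_op_persists[where j = "inst_pos \<Phi>" and a = "inst_op \<Phi>"])
       (auto simp: instance_in_def takes_step_at_def)
  ultimately show False by simp
qed

lemma step_of_unique_instance:
  assumes "infinite_execution X I \<alpha>"
    and "instance_in \<alpha> \<Phi>" "takes_step_at I \<alpha> \<Phi> k"
    and "instance_in \<alpha> \<Psi>" "takes_step_at I \<alpha> \<Psi> k"
  shows "\<Phi> = \<Psi>"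
proof -
  have proc: "inst_proc \<Phi> = inst_proc \<Psi>"
    and "inst_pos \<Phi> < k" "inst_pos \<Psi> < k"
    using assms(3,5) by (auto simp: takes_step_at_def)
  \<comment> \<open>Otherwise the later of the two invocations would be a reinvocation by the same
    process before step \<open>k\<close>.\<close>
  then have "\<not> inst_pos \<Phi> < inst_pos \<Psi>" "\<not> inst_pos \<Psi> < inst_pos \<Phi>"
    using no_step_after_reinvocation[OF assms(1-3)] no_step_after_reinvocation[OF assms(1,4,5)]
      assms(2,4) by (metis instance_in_def)+
  then have "inst_pos \<Phi> = inst_pos \<Psi>" by simp
  with proc show ?thesis using assms(2,4) by (simp add: instance_in_def)
qed

lemma instance_op_in_ops:
  assumes "infinite_execution X I \<alpha>" "instance_in \<alpha> \<Phi>"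
  shows "inst_op \<Phi> \<in> ops X"
proof -
  have "enabled X (\<alpha> (inst_pos \<Phi>)) (config_at I \<alpha> (inst_pos \<Phi>))"
    using assms(1) by (simp add: infinite_execution_def)
  then show ?thesis using assms(2) by (simp add: instance_in_def)
qed

lemma ev_conflict_step_contention_free_iff:
  assumes "conflict_rel X = ops X \<times> ops X"
    and exec: "infinite_execution X I \<alpha>" and inst: "instance_in \<alpha> \<Phi>"
  shows "ev_conflict_step_contention_free X I \<alpha> \<Phi> \<longleftrightarrow> ev_step_contention_free I \<alpha> \<Phi>"
proof -
  \<comment> \<open>Executions invoke only operations in \<open>ops X\<close>, so the hypothesis on
    \<open>conflict_rel X\<close> applies.\<close>
  have conflict: "(inst_op \<Phi>, inst_op \<Psi>) \<in> conflict_rel X" if "instance_in \<alpha> \<Psi>" for \<Psi>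
    using assms that instance_op_in_ops by blast
  \<comment> \<open>The equivalence holds at each position \<open>k\<close> separately, so the same
    bound \<open>N\<close> serves both conditions.\<close>
  have "(\<nexists>\<Psi>. instance_in \<alpha> \<Psi> \<and> \<Psi> \<noteq> \<Phi> \<and> (inst_op \<Phi>, inst_op \<Psi>) \<in> conflict_rel X \<and>
           takes_step_at I \<alpha> \<Psi> k) \<longleftrightarrow>
        (\<forall>p. \<alpha> k = Step p \<longrightarrow> takes_step_at I \<alpha> \<Phi> k)" for k
  proof
    assume "\<nexists>\<Psi>. instance_in \<alpha> \<Psi> \<and> \<Psi> \<noteq> \<Phi> \<and> (inst_op \<Phi>, inst_op \<Psi>) \<in> conflict_rel X \<and>
              takes_step_at I \<alpha> \<Psi> k"
    then show "\<forall>p. \<alpha> k = Step p \<longrightarrow> takes_step_at I \<alpha> \<Phi> k"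
      using conflict step_of_some_instance[OF exec] by metis
  next
    assume "\<forall>p. \<alpha> k = Step p \<longrightarrow> takes_step_at I \<alpha> \<Phi> k"
    then show "\<nexists>\<Psi>. instance_in \<alpha> \<Psi> \<and> \<Psi> \<noteq> \<Phi> \<and>
        (inst_op \<Phi>, inst_op \<Psi>) \<in> conflict_rel X \<and> takes_step_at I \<alpha> \<Psi> k"
      \<comment> \<open>A step of \<Psi> at \<open>k\<close> makes \<open>\<alpha> k\<close> a step
        event, hence by assumption also a step of \<Phi>; uniqueness then forces \<Psi> to be
        \<Phi>.\<close>
      using step_of_unique_instance[OF exec inst] by (metis takes_step_at_def)
  qed
  then show ?thesis
    by (simp only: ev_conflict_step_contention_free_def ev_step_contention_free_def)
qed

theorem lemma1:
  fixes X :: "('q, 'o, 'r) seq_object"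
    and I :: "('p::finite, 'g, 'v, 'l, 'o, 'r) impl"
  assumes "sequential_object X"
    and "implementation_of I X"
    and "conflict_rel X = ops X \<times> ops X"
  shows "conflict_obstruction_free X I \<longleftrightarrow> obstruction_free X I"
  \<comment> \<open>The two progress properties differ only in their contention premise.\<close>
  using ev_conflict_step_contention_free_iff[OF assms(3)]
  unfolding conflict_obstruction_free_def obstruction_free_def by blast

end
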